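(* Let $k \ge 0$ be an integer, let $n = 2k+1$, and let $M_n$ denote the adjacency matrix of the middle-cube graph on the middle two layers of the $n$-dimensional hypercube. Then the characteristic polynomial of $M_n$ is $$\det(\lambda I - M_n) = \prod_{i=1}^{k+1} \big((\lambda - i)(\lambda + i)\big)^{\binom{n}{k+1-i} - \binom{n}{k-i}}.$$
   Context: The $n$-dimensional hypercube $Q_n$ has as vertices the $2^n$ binary strings of length $n$, two being adjacent if and only if they differ in exactly one bit. For odd $n = 2k+1$, the middle-cube $M_n$ is the subgraph of $Q_n$ induced by all vertices whose binary string has exactly $k$ ones or exactly $k+1$ ones. Equivalently, its vertices are the $k$-subsets and the $(k+1)$-subsets of $\{1,\dots,n\}$, two distinct vertices $A,B$ being adjacent if and only if $A \subset B$ or $B \subset A$. The same symbol $M_n$ denotes the graph and its adjacency matrix. $I$ is the identity matrix of the same size. Convention: $\binom{n}{-1} = 0$. *)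

theory Defs
  imports
    "Graph_Theory.Graph_Theory"
    "Jordan_Normal_Form.Char_Poly"
begin

definition hypercube :: "nat \<Rightarrow> (bool list, bool list \<times> bool list) pre_digraph" where
  "hypercube n = with_proj
     \<lparr> pverts = {x. length x = n},
       parcs = {(x, y). length x = n \<and> length y = n \<and> card {i. i < n \<and> x ! i \<noteq> y ! i} = 1} \<rparr>"

text \<open>The parameter is the lower of the two layers: \<open>middle_cube k\<close> is \<open>M\<^sub>n\<close> for \<open>n = 2 * k + 1\<close>.\<close>

definition middle_cube :: "nat \<Rightarrow> (bool list, bool list \<times> bool list) pre_digraph" where
  "middle_cube k =
     (let n = 2 * k + 1
      in hypercube n \<restriction> {x \<in> verts (hypercube n). count_list x True = k \<or> count_list x True = k + 1})"

text \<open>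
  Matrices are indexed by natural numbers, so the adjacency matrix depends on a list \<open>vs\<close> that
  enumerates the vertices of \<open>G\<close> without repetition.
\<close>

definition adjacency_matrix :: "('a, 'b) pre_digraph \<Rightarrow> 'a list \<Rightarrow> real mat" where
  "adjacency_matrix G vs =
     mat (length vs) (length vs) (\<lambda>(i, j). if vs ! i \<rightarrow>\<^bsub>G\<^esub> vs ! j then 1 else 0)"

text \<open>The lower argument is an integer, so that \<open>binom n (- 1) = 0\<close>.\<close>

definition binom :: "nat \<Rightarrow> int \<Rightarrow> nat" where
  "binom n j = (if j < 0 then 0 else n choose nat j)"

text \<open>The natural-number difference of these two binomial coefficients is not truncated.\<close>

lemma binom_middle_mono:
  assumes "i \<ge> 1"
  shows "binom (2 * k + 1) (int k - int i) \<le> binom (2 * k + 1) (int k + 1 - int i)"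
  using assms by (auto simp: binom_def intro!: binomial_mono)

lemma graph_hypercube: "graph (hypercube n)"
proof
  have "finite {x :: bool list. length x = n}"
    using finite_lists_length_eq[OF finite[of "UNIV :: bool set"], of n]
    by (simp only: subset_UNIV simp_thms)
  then show fin: "finite (verts (hypercube n))"
    by (simp add: hypercube_def)
  have "arcs (hypercube n) \<subseteq> verts (hypercube n) \<times> verts (hypercube n)"
    by (auto simp: hypercube_def)
  then show "finite (arcs (hypercube n))"
    by (rule finite_subset) (intro finite_cartesian_product fin)
  have "(y, x) \<in> arcs_ends (hypercube n)" if "(x, y) \<in> arcs_ends (hypercube n)" for x y
  proof -
    have "{i. i < n \<and> y ! i \<noteq> x ! i} = {i. i < n \<and> x ! i \<noteq> y ! i}"
      by blast
    with that show ?thesis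
      unfolding hypercube_def by (simp only: with_proj_simps pair_pre_digraph.select_convs mem_Collect_eq prod.case)
  qed
  then show "symmetric (hypercube n)"
    unfolding symmetric_def by (rule symI)
  show "tail (hypercube n) e \<noteq> head (hypercube n) e" if "e \<in> arcs (hypercube n)" for e
    using that by (cases e) (auto simp: hypercube_def)
  show "e = e'" if "arc_to_ends (hypercube n) e = arc_to_ends (hypercube n) e'" for e e'
    using that by (simp add: arc_to_ends_def hypercube_def prod_eq_iff)
qed (auto simp: hypercube_def)

lemma graph_middle_cube: "graph (middle_cube k)"
proof -
  interpret graph "hypercube (2 * k + 1)" by (rule graph_hypercube)
  have *: "induced_subgraph (middle_cube k) (hypercube (2 * k + 1))"
    unfolding middle_cube_def Let_def by (rule induced_induce) auto
  show ?thesis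
    using digraphI_induced[OF *] induced_graph_imp_symmetric[OF sym_arcs *]
    by (rule digraph.graphI)
qed

end

theory Submission
  imports Defs
begin

text \<open>
  Let \<open>W\<^sub>j\<close> be the inclusion matrix between the \<open>j\<close>-subsets and the \<open>(j + 1)\<close>-subsets of an
  \<open>n\<close>-set. Counting common supersets and common subsets gives
  \<open>W\<^sub>j W\<^sub>j\<^sup>T = W\<^sub>j\<^sub>-\<^sub>1\<^sup>T W\<^sub>j\<^sub>-\<^sub>1 + (n - 2 j) I\<close>, and the characteristic polynomials of
  \<open>W\<^sub>j\<^sub>-\<^sub>1\<^sup>T W\<^sub>j\<^sub>-\<^sub>1\<close> and \<open>W\<^sub>j\<^sub>-\<^sub>1 W\<^sub>j\<^sub>-\<^sub>1\<^sup>T\<close> differ only by a power of the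
  variable. Induction on \<open>j\<close> thus yields, without any eigenvectors, that \<open>W\<^sub>j W\<^sub>j\<^sup>T\<close> has the
  eigenvalues \<open>(j + 1 - i) (n - i - j)\<close>, where \<open>i = 0, \<dots>, j\<close>, with multiplicities
  \<open>(n choose i) - (n choose (i - 1))\<close>. For \<open>n = 2 k + 1\<close> and \<open>j = k\<close> these are the squares
  \<open>(k + 1 - i)\<^sup>2\<close>, and \<open>M\<^sub>n\<close> is the block matrix with off-diagonal blocks \<open>W\<^sub>k\<close> and
  \<open>W\<^sub>k\<^sup>T\<close>, so \<open>det (x I - M\<^sub>n) = det (x\<^sup>2 I - W\<^sub>k W\<^sub>k\<^sup>T)\<close>.
\<close>

section \<open>Characteristic polynomials\<close>

text \<open>Reduces identities between characteristic polynomials to determinant identities at each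
  scalar; over an infinite field \<open>poly_ext\<close> then recovers the polynomials.\<close>

lemma poly_char_poly:
  fixes A :: "'a :: field mat"
  assumes "A \<in> carrier_mat n n"
  shows "poly (char_poly A) x = det (x \<cdot>\<^sub>m 1\<^sub>m n - A)"
  unfolding char_poly_matrix[OF assms]
  by (rule arg_cong[of _ _ det]) (use assms in \<open>auto simp: char_matrix_def\<close>)

lemma char_poly_add_smult_one:
  fixes A :: "'a :: field_char_0 mat"
  assumes A: "A \<in> carrier_mat n n"
  shows "char_poly (A + c \<cdot>\<^sub>m 1\<^sub>m n) = char_poly A \<circ>\<^sub>p [:- c, 1:]"
proof (rule poly_ext)
  fix x
  have "x \<cdot>\<^sub>m 1\<^sub>m n - (A + c \<cdot>\<^sub>m 1\<^sub>m n) = (x - c) \<cdot>\<^sub>m 1\<^sub>m n - A"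
    using A by (auto simp: algebra_simps)
  moreover have Ac: "A + c \<cdot>\<^sub>m 1\<^sub>m n \<in> carrier_mat n n"
    using A by auto
  ultimately show "poly (char_poly (A + c \<cdot>\<^sub>m 1\<^sub>m n)) x = poly (char_poly A \<circ>\<^sub>p [:- c, 1:]) x"
    by (simp add: poly_char_poly[OF A] poly_char_poly[OF Ac] poly_pcompose)
qed

text \<open>Two block eliminations of the same matrix \<open>M\<close> each give its determinant up
  to a power of \<open>x\<close>. Nothing is divided by \<open>x\<close>, so \<open>x = 0\<close> is
  covered.\<close>

lemma det_mult_swap:
  fixes B C :: "'a :: field mat"
  assumes B: "B \<in> carrier_mat n m" and C: "C \<in> carrier_mat m n"
  shows "x ^ m * det (x \<cdot>\<^sub>m 1\<^sub>m n - B * C) = x ^ n * det (x \<cdot>\<^sub>m 1\<^sub>m m - C * B)"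
proof -
  define M where "M = four_block_mat (x \<cdot>\<^sub>m 1\<^sub>m n) B C (1\<^sub>m m)"
  have BC: "B * C \<in> carrier_mat n n" and CB: "C * B \<in> carrier_mat m m"
    using B C by auto
  have M: "M \<in> carrier_mat (n + m) (n + m)"
    unfolding M_def by auto
  \<comment> \<open>Clearing the block \<open>B\<close> leaves the Schur complement of the identity
    block.\<close>
  have 1: "M = four_block_mat (1\<^sub>m n) B (0\<^sub>m m n) (1\<^sub>m m)
      * four_block_mat (x \<cdot>\<^sub>m 1\<^sub>m n - B * C) (0\<^sub>m n m) C (1\<^sub>m m)"
    unfolding M_def
    by (subst mult_four_block_mat[of _ n n _ m _ m _ _ n _ m])
       (use B C BC CB in \<open>auto intro!: cong_four_block_mat\<close>)
  have "det M = det (x \<cdot>\<^sub>m 1\<^sub>m n - B * C)"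
    unfolding 1
    using det_mult[of "four_block_mat (1\<^sub>m n) B (0\<^sub>m m n) (1\<^sub>m m)" "n + m"
        "four_block_mat (x \<cdot>\<^sub>m 1\<^sub>m n - B * C) (0\<^sub>m n m) C (1\<^sub>m m)"]
      det_four_block_mat_lower_left_zero[OF one_carrier_mat B refl one_carrier_mat]
      det_four_block_mat_upper_right_zero[OF minus_carrier_mat[OF BC] refl C one_carrier_mat]
      minus_carrier_mat[OF BC]
    by simp
  \<comment> \<open>Here \<open>C\<close> is cleared instead; scaling the lower rows by
    \<open>x\<close> avoids an inverse of \<open>x\<close> and contributes the factor
    \<open>x ^ m\<close>.\<close>
  moreover have 2: "four_block_mat (1\<^sub>m n) (0\<^sub>m n m) (- C) (x \<cdot>\<^sub>m 1\<^sub>m m) * M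
      = four_block_mat (x \<cdot>\<^sub>m 1\<^sub>m n) B (0\<^sub>m m n) (x \<cdot>\<^sub>m 1\<^sub>m m - C * B)"
    unfolding M_def
    by (subst mult_four_block_mat[of _ n n _ m _ m _ _ n _ m])
       (use B C BC CB in \<open>auto intro!: cong_four_block_mat\<close>)
  have "x ^ m * det M = x ^ n * det (x \<cdot>\<^sub>m 1\<^sub>m m - C * B)"
    using arg_cong[OF 2, of det]
      det_mult[OF _ M, of "four_block_mat (1\<^sub>m n) (0\<^sub>m n m) (- C) (x \<cdot>\<^sub>m 1\<^sub>m m)"]
      det_four_block_mat_upper_right_zero[OF one_carrier_mat refl uminus_carrier_mat[OF C]
        smult_carrier_mat[OF one_carrier_mat, of x]]
      det_four_block_mat_lower_left_zero[OF smult_carrier_mat[OF one_carrier_mat, of x] B refl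
        minus_carrier_mat[OF CB]]
    by simp
  ultimately show ?thesis by simp
qed

lemma char_poly_mult_swap:
  fixes B C :: "'a :: field_char_0 mat"
  assumes B: "B \<in> carrier_mat n m" and C: "C \<in> carrier_mat m n" and "n \<le> m"
  shows "char_poly (C * B) = [:0, 1:] ^ (m - n) * char_poly (B * C)"
proof -
  have BC: "B * C \<in> carrier_mat n n" and CB: "C * B \<in> carrier_mat m m"
    using B C by auto
  have "[:0, 1:] ^ m * char_poly (B * C) = [:0, 1:] ^ n * char_poly (C * B)"
    by (rule poly_ext)
       (simp add: poly_char_poly[OF BC] poly_char_poly[OF CB] det_mult_swap[OF B C])
  moreover have "[:0, 1 :: 'a:] ^ m = [:0, 1:] ^ n * [:0, 1:] ^ (m - n)"
    using \<open>n \<le> m\<close> by (simp flip: power_add)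
  ultimately have "[:0, 1:] ^ n * ([:0, 1:] ^ (m - n) * char_poly (B * C)) = [:0, 1:] ^ n * char_poly (C * B)"
    by (simp add: mult.assoc)
  then show ?thesis
    by (simp only: mult_cancel_left) simp
qed

text \<open>The lower blocks \<open>- C\<close> and \<open>x I\<close> commute, so the block
  determinant is that of a single \<open>n\<close> by \<open>n\<close> matrix, in which
  \<open>x\<close> enters only as its square.\<close>

lemma char_poly_bipartite:
  fixes B C :: "'a :: field_char_0 mat"
  assumes B: "B \<in> carrier_mat n n" and C: "C \<in> carrier_mat n n"
  shows "char_poly (four_block_mat (0\<^sub>m n n) B C (0\<^sub>m n n)) = char_poly (B * C) \<circ>\<^sub>p [:0, 0, 1:]"
proof (rule poly_ext)
  fix x
  let ?M = "four_block_mat (0\<^sub>m n n) B C (0\<^sub>m n n)"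
  have BC: "B * C \<in> carrier_mat n n"
    using B C by auto
  have "poly (char_poly ?M) x = det (x \<cdot>\<^sub>m 1\<^sub>m (n + n) - ?M)"
    by (rule poly_char_poly) auto
  also have "x \<cdot>\<^sub>m 1\<^sub>m (n + n) - ?M = four_block_mat (x \<cdot>\<^sub>m 1\<^sub>m n) (- B) (- C) (x \<cdot>\<^sub>m 1\<^sub>m n)"
    by (rule eq_matI) (use B C in auto)
  also have "det \<dots> = det (x \<cdot>\<^sub>m 1\<^sub>m n * (x \<cdot>\<^sub>m 1\<^sub>m n) - (- B) * (- C))"
    by (rule det_four_block_mat) (use B C in auto)
  also have "x \<cdot>\<^sub>m 1\<^sub>m n * (x \<cdot>\<^sub>m 1\<^sub>m n) - (- B) * (- C) = x\<^sup>2 \<cdot>\<^sub>m 1\<^sub>m n - B * C"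
    by (rule eq_matI) (use B C in \<open>auto simp: power2_eq_square\<close>)
  also have "det \<dots> = poly (char_poly (B * C)) (x\<^sup>2)"
    using poly_char_poly[OF BC] by simp
  finally show "poly (char_poly ?M) x = poly (char_poly (B * C) \<circ>\<^sub>p [:0, 0, 1:]) x"
    by (simp add: poly_pcompose power2_eq_square)
qed

section \<open>Independence of the order of rows and columns\<close>

lemma det_permute_simultaneously:
  assumes A: "A \<in> carrier_mat n n" and p: "p permutes {0..<n}"
  shows "det (mat n n (\<lambda>(i, j). A $$ (p i, p j))) = det A"
proof -
  define B where "B = mat n n (\<lambda>(i, j). A $$ (i, p j))"
  have pi: "p i < n" if "i < n" for i
    using permutes_in_image[OF p, of i] that by simp
  have "mat n n (\<lambda>(i, j). A $$ (p i, p j)) = mat n n (\<lambda>(i, j). B $$ (p i, j))"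
    by (rule eq_matI) (auto simp: B_def pi)
  also have "det \<dots> = signof p * det B"
    by (rule det_permute_rows[OF _ p]) (simp add: B_def)
  also have "det B = det (transpose_mat B)"
    by (rule det_transpose[symmetric, of _ n]) (simp add: B_def)
  also have "transpose_mat B = mat n n (\<lambda>(i, j). transpose_mat A $$ (p i, j))"
    by (rule eq_matI) (use A in \<open>auto simp: B_def pi\<close>)
  also have "det \<dots> = signof p * det (transpose_mat A)"
    by (rule det_permute_rows[OF _ p]) (use A in simp)
  also have "det (transpose_mat A) = det A"
    by (rule det_transpose[OF A])
  finally show ?thesis
    by (simp add: sign_def)
qed

text \<open>Makes the result independent of the vertex enumeration: reordering conjugates by a
  permutation, whose sign occurs twice and cancels.\<close>

lemma char_poly_reorder:
  fixes f :: "'b \<Rightarrow> 'b \<Rightarrow> 'a :: comm_ring_1"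
  assumes "mset vs = mset ws"
  shows "char_poly (mat (length vs) (length vs) (\<lambda>(i, j). f (vs ! i) (vs ! j)))
       = char_poly (mat (length ws) (length ws) (\<lambda>(i, j). f (ws ! i) (ws ! j)))"
proof -
  obtain p where p: "p permutes {..<length ws}" and vs: "permute_list p ws = vs"
    using mset_eq_permutation[OF assms] .
  define n where "n = length ws"
  have pn: "p permutes {0..<n}"
    using p by (simp add: n_def atLeast0LessThan)
  have pi: "p i < n" if "i < n" for i
    using permutes_in_image[OF pn, of i] that by simp
  have len: "length vs = n"
    using vs n_def by auto
  have nth: "vs ! i = ws ! p i" if "i < n" for i
    using permute_list_nth[OF p] that vs n_def by auto
  let ?W = "mat n n (\<lambda>(i, j). f (ws ! i) (ws ! j))"
  \<comment> \<open>Injectivity of \<open>p\<close> ensures that the indeterminate stays exactly on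
    the diagonal.\<close>
  have "char_poly_matrix (mat n n (\<lambda>(i, j). f (vs ! i) (vs ! j)))
      = mat n n (\<lambda>(i, j). char_poly_matrix ?W $$ (p i, p j))"
    by (rule eq_matI)
       (auto simp: char_poly_matrix_def nth pi dest: permutes_inj[OF pn, THEN injD])
  then show ?thesis
    using det_permute_simultaneously[OF _ pn, of "char_poly_matrix ?W"]
    by (simp add: char_poly_def len flip: n_def)
qed

section \<open>Inclusion matrices between layers of the Boolean lattice\<close>

text \<open>The ground set starts at 0 so that its elements are the positions in a bit
  string.\<close>

definition layer :: "nat \<Rightarrow> nat \<Rightarrow> nat set set" where
  "layer n j = {S. S \<subseteq> {..<n} \<and> card S = j}"

definition inclusion_matrix :: "'a set list \<Rightarrow> 'a set list \<Rightarrow> real mat" where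
  "inclusion_matrix xs ys =
     mat (length xs) (length ys) (\<lambda>(i, j). if xs ! i \<subseteq> ys ! j then 1 else 0)"

lemma inclusion_matrix_carrier [simp]:
  "inclusion_matrix xs ys \<in> carrier_mat (length xs) (length ys)"
  by (simp add: inclusion_matrix_def)

lemma inclusion_matrix_dim [simp]:
  "dim_row (inclusion_matrix xs ys) = length xs"
  "dim_col (inclusion_matrix xs ys) = length ys"
  by (simp_all add: inclusion_matrix_def)

lemma finite_layer [simp]: "finite (layer n j)"
  by (rule finite_subset[of _ "Pow {..<n}"]) (auto simp: layer_def)

lemma card_layer: "card (layer n j) = n choose j"
  using n_subsets[of "{..<n}" j] by (simp add: layer_def)

lemma length_layer_list:
  assumes "distinct xs" "set xs = layer n j"
  shows "length xs = n choose j"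
  using assms distinct_card[of xs] by (simp add: card_layer)

lemma sum_if_nth_eq_card:
  assumes "distinct xs"
  shows "(\<Sum>l = 0..<length xs. if P (xs ! l) then 1 else 0) = real (card {x \<in> set xs. P x})"
proof -
  have "(\<Sum>l = 0..<length xs. if P (xs ! l) then 1 else 0 :: real) = (\<Sum>x \<in> set xs. if P x then 1 else 0)"
    by (rule sum.reindex_bij_betw) (use assms in \<open>auto intro: bij_betw_nth\<close>)
  also have "\<dots> = real (card {x \<in> set xs. P x})"
    by (simp flip: sum.inter_filter)
  finally show ?thesis .
qed

section \<open>Products of inclusion matrices as counts of common supersets and subsets\<close>

lemma common_supersets:
  assumes "distinct zs" "i < length xs" "j < length xs"
  shows "(inclusion_matrix xs zs * transpose_mat (inclusion_matrix xs zs)) $$ (i, j)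
       = card {Z \<in> set zs. xs ! i \<subseteq> Z \<and> xs ! j \<subseteq> Z}"
proof -
  have "(inclusion_matrix xs zs * transpose_mat (inclusion_matrix xs zs)) $$ (i, j)
      = (\<Sum>l = 0..<length zs. if xs ! i \<subseteq> zs ! l \<and> xs ! j \<subseteq> zs ! l then 1 else 0)"
    using assms by (auto simp: inclusion_matrix_def scalar_prod_def intro!: sum.cong)
  also have "\<dots> = card {Z \<in> set zs. xs ! i \<subseteq> Z \<and> xs ! j \<subseteq> Z}"
    by (rule sum_if_nth_eq_card[OF assms(1)])
  finally show ?thesis .
qed

lemma common_subsets:
  assumes "distinct ys" "i < length xs" "j < length xs"
  shows "(transpose_mat (inclusion_matrix ys xs) * inclusion_matrix ys xs) $$ (i, j)
       = card {Y \<in> set ys. Y \<subseteq> xs ! i \<and> Y \<subseteq> xs ! j}"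
proof -
  have "(transpose_mat (inclusion_matrix ys xs) * inclusion_matrix ys xs) $$ (i, j)
      = (\<Sum>l = 0..<length ys. if ys ! l \<subseteq> xs ! i \<and> ys ! l \<subseteq> xs ! j then 1 else 0)"
    using assms by (auto simp: inclusion_matrix_def scalar_prod_def intro!: sum.cong)
  also have "\<dots> = card {Y \<in> set ys. Y \<subseteq> xs ! i \<and> Y \<subseteq> xs ! j}"
    by (rule sum_if_nth_eq_card[OF assms(1)])
  finally show ?thesis .
qed

text \<open>Each such superset arises from exactly one choice of an added element outside
  \<open>S\<close>.\<close>

lemma card_supersets_layer_Suc:
  assumes "S \<in> layer n j"
  shows "card {Z \<in> layer n (Suc j). S \<subseteq> Z} = n - j"
proof -
  have S: "S \<subseteq> {..<n}" "card S = j" "finite S"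
    using assms by (auto simp: layer_def intro: finite_subset)
  have "{Z \<in> layer n (Suc j). S \<subseteq> Z} = (\<lambda>a. insert a S) ` ({..<n} - S)" (is "?L = ?R")
  proof
    show "?R \<subseteq> ?L"
      using S by (auto simp: layer_def)
    show "?L \<subseteq> ?R"
    proof
      fix Z assume "Z \<in> ?L"
      then have Z: "Z \<subseteq> {..<n}" "card Z = Suc j" "S \<subseteq> Z"
        by (auto simp: layer_def)
      have "card (Z - S) = 1"
        using Z S by (simp add: card_Diff_subset)
      then obtain a where "Z - S = {a}"
        by (auto simp: card_1_singleton_iff)
      then have "Z = insert a S" "a \<in> {..<n} - S"
        using Z by auto
      then show "Z \<in> ?R" by blast
    qed
  qed
  moreover have "inj_on (\<lambda>a. insert a S) ({..<n} - S)"
    by (auto simp: inj_on_def)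
  ultimately show ?thesis
    using S by (simp add: card_image card_Diff_subset)
qed

lemma card_subsets_layer:
  assumes "S \<in> layer n (Suc j)"
  shows "card {Y \<in> layer n j. Y \<subseteq> S} = Suc j"
proof -
  have "{Y \<in> layer n j. Y \<subseteq> S} = {Y. Y \<subseteq> S \<and> card Y = j}"
    using assms by (auto simp: layer_def)
  moreover have "finite S"
    using assms by (auto simp: layer_def intro: finite_subset)
  ultimately show ?thesis
    using n_subsets[of S j] assms by (simp add: layer_def)
qed

text \<open>
  Two distinct \<open>(j + 1)\<close>-sets \<open>S\<close> and \<open>T\<close> have a common superset of size \<open>j + 2\<close> only if it is
  \<open>S \<union> T\<close>, a common subset of size \<open>j\<close> only if it is \<open>S \<inter> T\<close>, and both occur together.
\<close>

lemma card_common_supersets_eq_subsets: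
  assumes S: "S \<in> layer n (Suc j)" and T: "T \<in> layer n (Suc j)" and "S \<noteq> T"
  shows "card {Z \<in> layer n (Suc (Suc j)). S \<subseteq> Z \<and> T \<subseteq> Z} = card {Y \<in> layer n j. Y \<subseteq> S \<and> Y \<subseteq> T}"
proof -
  have fin: "finite S" "finite T" and sub: "S \<subseteq> {..<n}" "T \<subseteq> {..<n}"
    and card: "card S = Suc j" "card T = Suc j"
    using S T by (auto simp: layer_def intro: finite_subset)
  \<comment> \<open>This identity makes the union have size \<open>j + 2\<close> exactly when the
    intersection has size \<open>j\<close>.\<close>
  have un: "card (S \<union> T) + card (S \<inter> T) = 2 * Suc j"
    using card_Un_Int[OF fin] card by simp
  have "card (S \<inter> T) < Suc j"
    using fin card \<open>S \<noteq> T\<close>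
    by (metis Int_lower1 Int_lower2 card_seteq leI)
  then have lt: "card (S \<inter> T) \<le> j" "card (S \<union> T) \<ge> Suc (Suc j)"
    using un by auto
  have "{Z \<in> layer n (Suc (Suc j)). S \<subseteq> Z \<and> T \<subseteq> Z} = (if card (S \<inter> T) = j then {S \<union> T} else {})"
  proof -
    have "Z = S \<union> T" if "Z \<in> layer n (Suc (Suc j))" "S \<subseteq> Z" "T \<subseteq> Z" for Z
      using that lt card_seteq[of Z "S \<union> T"] by (auto simp: layer_def intro: finite_subset)
    then show ?thesis
      using un sub by (auto simp: layer_def)
  qed
  moreover have "{Y \<in> layer n j. Y \<subseteq> S \<and> Y \<subseteq> T} = (if card (S \<inter> T) = j then {S \<inter> T} else {})"
  proof -
    have "Y = S \<inter> T" if "Y \<in> layer n j" "Y \<subseteq> S" "Y \<subseteq> T" for Y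
      using that lt fin card_seteq[of "S \<inter> T" Y] by (auto simp: layer_def)
    then show ?thesis
      using sub by (auto simp: layer_def)
  qed
  ultimately show ?thesis by simp
qed

section \<open>The spectrum of the up-down products, layer by layer\<close>

lemma up_down_commutation:
  assumes ys: "distinct ys" "set ys = layer n j"
    and xs: "distinct xs" "set xs = layer n (Suc j)"
    and zs: "distinct zs" "set zs = layer n (Suc (Suc j))"
    and "Suc j \<le> n"
  shows "inclusion_matrix xs zs * transpose_mat (inclusion_matrix xs zs)
       = transpose_mat (inclusion_matrix ys xs) * inclusion_matrix ys xs
         + (real n - 2 * real (Suc j)) \<cdot>\<^sub>m 1\<^sub>m (length xs)"
    (is "?L = ?R + ?c \<cdot>\<^sub>m _")
proof (rule eq_matI)
  fix a b
  assume "a < dim_row (?R + ?c \<cdot>\<^sub>m 1\<^sub>m (length xs))" "b < dim_col (?R + ?c \<cdot>\<^sub>m 1\<^sub>m (length xs))"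
  then have ab: "a < length xs" "b < length xs"
    by auto
  then have lay: "xs ! a \<in> layer n (Suc j)" "xs ! b \<in> layer n (Suc j)"
    using nth_mem[of a xs] nth_mem[of b xs] xs(2) by simp_all
  have L: "?L $$ (a, b) = card {Z \<in> layer n (Suc (Suc j)). xs ! a \<subseteq> Z \<and> xs ! b \<subseteq> Z}"
    using common_supersets[OF zs(1) ab] zs(2) by simp
  have R: "?R $$ (a, b) = card {Y \<in> layer n j. Y \<subseteq> xs ! a \<and> Y \<subseteq> xs ! b}"
    using common_subsets[OF ys(1) ab] ys(2) by simp
  have "(?R + ?c \<cdot>\<^sub>m 1\<^sub>m (length xs)) $$ (a, b) = ?R $$ (a, b) + (if a = b then ?c else 0)"
    using ab by simp
  also have "\<dots> = ?L $$ (a, b)"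
  \<comment> \<open>On the diagonal there are \<open>n - Suc j\<close> supersets against
    \<open>Suc j\<close> subsets, whence the constant; off the diagonal the two counts
    agree.\<close>
  proof (cases "a = b")
    case True
    then show ?thesis
      using card_supersets_layer_Suc[OF lay(1)] card_subsets_layer[OF lay(1)] \<open>Suc j \<le> n\<close>
      unfolding L R by (simp add: of_nat_diff)
  next
    case False
    then have "xs ! a \<noteq> xs ! b"
      using ab xs(1) by (simp add: nth_eq_iff_index_eq)
    then show ?thesis
      using card_common_supersets_eq_subsets[OF lay] False unfolding L R by simp
  qed
  finally show "?L $$ (a, b) = (?R + ?c \<cdot>\<^sub>m 1\<^sub>m (length xs)) $$ (a, b)" by simp
qed auto

text \<open>Passing to the next layer adds zero eigenvalues and then shifts the whole spectrum. The
  bound \<open>2 * j \<le> n\<close> keeps the binomials increasing, so no exponent is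
  truncated.\<close>

lemma char_poly_up_down:
  assumes "distinct xs" "set xs = layer n j" "distinct zs" "set zs = layer n (Suc j)" "2 * j \<le> n"
  shows "char_poly (inclusion_matrix xs zs * transpose_mat (inclusion_matrix xs zs))
       = (\<Prod>i\<le>j. [:- ((real j + 1 - real i) * (real n - real i - real j)), 1:]
            ^ (binom n (int i) - binom n (int i - 1)))"
  using assms
proof (induction j arbitrary: xs zs)
  \<comment> \<open>The only row belongs to the empty set, which lies in all \<open>n\<close>
    singletons.\<close>
  case 0
  have l0: "layer n 0 = {{}}"
    by (auto simp: layer_def card_eq_0_iff dest: finite_subset[OF _ finite_lessThan])
  have len: "length xs = 1"
    using length_layer_list[OF 0(1,2)] by simp
  then have "xs ! 0 \<in> set xs"
    by (intro nth_mem) simp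
  then have xs: "xs ! 0 = {}"
    unfolding 0(2) l0 by (rule singletonD)
  let ?A = "inclusion_matrix xs zs * transpose_mat (inclusion_matrix xs zs)"
  have A: "?A \<in> carrier_mat 1 1"
    by (rule mult_carrier_mat[of _ _ "length zs"], unfold transpose_carrier_mat)
       (use inclusion_matrix_carrier[of xs zs] in \<open>simp_all only: len\<close>)
  have "card {Z \<in> layer n (Suc 0). {} \<subseteq> Z} = n"
    using card_supersets_layer_Suc[of "{}" n 0] unfolding l0 by simp
  moreover have "?A $$ (0, 0) = card {Z \<in> layer n (Suc 0). {} \<subseteq> Z}"
    using common_supersets[OF 0(3), of 0 xs 0] unfolding 0(4) xs len by simp
  ultimately have A00: "?A $$ (0, 0) = n"
    by metis
  have "char_poly ?A = [:- real n, 1:]"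
  proof (rule poly_ext)
    fix x
    have "poly (char_poly ?A) x = (x \<cdot>\<^sub>m 1\<^sub>m 1 - ?A) $$ (0, 0)"
      unfolding poly_char_poly[OF A] by (rule det_single) (rule minus_carrier_mat[OF A])
    also have "\<dots> = x - ?A $$ (0, 0)"
      using carrier_matD[OF A] by (subst index_minus_mat) simp_all
    finally show "poly (char_poly ?A) x = poly [:- real n, 1:] x"
      unfolding A00 by simp
  qed
  then show ?case
    by (simp add: binom_def)
next
  case (Suc j)
  obtain ys where ys: "distinct ys" "set ys = layer n j"
    using finite_distinct_list[OF finite_layer, of n j] by blast
  let ?W = "inclusion_matrix ys xs"
  let ?c = "real n - 2 * real (Suc j)"
  have len: "length ys = n choose j" "length xs = n choose Suc j"
    using ys Suc.prems by (auto intro: length_layer_list)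
  have le: "n choose j \<le> n choose Suc j"
    using Suc.prems by (intro binomial_mono) auto
  have "char_poly (inclusion_matrix xs zs * transpose_mat (inclusion_matrix xs zs))
      = char_poly (transpose_mat ?W * ?W + ?c \<cdot>\<^sub>m 1\<^sub>m (length xs))"
    using up_down_commutation[OF ys Suc.prems(1-4)] Suc.prems(5) by simp
  also have "\<dots> = char_poly (transpose_mat ?W * ?W) \<circ>\<^sub>p [:- ?c, 1:]"
    by (rule char_poly_add_smult_one, rule mult_carrier_mat[of _ _ "length ys"]) simp_all
  \<comment> \<open>The zero eigenvalues gained here become, after the shift, the new factor for
    \<open>i = Suc j\<close>, with root \<open>?c\<close>.\<close>
  also have "char_poly (transpose_mat ?W * ?W)
      = [:0, 1:] ^ (length xs - length ys) * char_poly (?W * transpose_mat ?W)"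
    by (rule char_poly_mult_swap) (use le len in auto)
  also have "char_poly (?W * transpose_mat ?W)
      = (\<Prod>i\<le>j. [:- ((real j + 1 - real i) * (real n - real i - real j)), 1:]
            ^ (binom n (int i) - binom n (int i - 1)))"
    using Suc.IH[OF ys Suc.prems(1,2)] Suc.prems(5) by simp
  also have "length xs - length ys = binom n (int (Suc j)) - binom n (int (Suc j) - 1)"
    by (simp add: len binom_def nat_add_distrib)
  \<comment> \<open>With \<open>a = j + 1 - i\<close> and \<open>b = n - i - j\<close>, the shift is
    \<open>?c = b - a - 1\<close>, so \<open>a * b + ?c = (a + 1) * (b - 1)\<close>, the eigenvalue
    for \<open>Suc j\<close>.\<close>
  finally show ?case
    unfolding prod.atMost_Suc
    by (intro poly_ext)
       (simp add: poly_pcompose poly_prod algebra_simps)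
qed

section \<open>Subsets and bit strings\<close>

definition bits :: "nat \<Rightarrow> nat set \<Rightarrow> bool list" where
  "bits n S = map (\<lambda>i. i \<in> S) [0..<n]"

lemma length_bits [simp]: "length (bits n S) = n"
  by (simp add: bits_def)

lemma nth_bits [simp]: "i < n \<Longrightarrow> bits n S ! i \<longleftrightarrow> i \<in> S"
  by (simp add: bits_def)

lemma count_list_bits:
  assumes "S \<subseteq> {..<n}"
  shows "count_list (bits n S) True = card S"
proof -
  have "{i. i < n \<and> i \<in> S} = S"
    using assms by auto
  then show ?thesis
    by (simp add: count_list_eq_length_filter length_filter_conv_card cong: conj_cong)
qed

lemma inj_on_bits: "inj_on (bits n) (Pow {..<n})"
proof (rule inj_onI)
  fix S T assume "S \<in> Pow {..<n}" "T \<in> Pow {..<n}" and eq: "bits n S = bits n T"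
  moreover have "i \<in> S \<longleftrightarrow> i \<in> T" if "i < n" for i
    using that eq nth_bits by metis
  ultimately show "S = T" by blast
qed

lemma bits_image_layer: "bits n ` layer n j = {x. length x = n \<and> count_list x True = j}"
proof (intro equalityI subsetI)
  fix x assume x: "x \<in> {x. length x = n \<and> count_list x True = j}"
  define S where "S = {i. i < n \<and> x ! i}"
  then have S: "S \<subseteq> {..<n}"
    by auto
  have *: "x = bits n S"
    using x by (intro nth_equalityI) (auto simp: S_def)
  then have "card S = j"
    using x count_list_bits[OF S] by simp
  then show "x \<in> bits n ` layer n j"
    using * S by (auto simp: layer_def)
qed (auto simp: layer_def count_list_bits)

section \<open>The middle-cube in terms of subsets\<close>

lemma verts_middle_cube:
  "verts (middle_cube k) = bits (2 * k + 1) ` (layer (2 * k + 1) k \<union> layer (2 * k + 1) (k + 1))"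
  unfolding image_Un bits_image_layer by (auto simp: middle_cube_def hypercube_def Let_def)

lemma dominates_middle_cube_iff:
  "x \<rightarrow>\<^bsub>middle_cube k\<^esub> y \<longleftrightarrow> x \<in> verts (middle_cube k) \<and> y \<in> verts (middle_cube k)
     \<and> card {i. i < 2 * k + 1 \<and> x ! i \<noteq> y ! i} = 1"
  by (auto simp: middle_cube_def hypercube_def Let_def arcs_ends_conv induce_subgraph_def image_iff)

text \<open>The sizes of \<open>S - T\<close> and \<open>T - S\<close> differ by as much as those of
  \<open>S\<close> and \<open>T\<close>. Hence the symmetric difference has even size in the first
  case and size \<open>2 * card (S - T) + 1\<close> in the second.\<close>

lemma card_symmetric_difference_eq_1_iff:
  assumes "finite S" "finite T"
  shows "card S = card T \<Longrightarrow> card ((S - T) \<union> (T - S)) \<noteq> 1"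
    and "card T = card S + 1 \<Longrightarrow> card ((S - T) \<union> (T - S)) = 1 \<longleftrightarrow> S \<subseteq> T"
proof -
  have un: "card ((S - T) \<union> (T - S)) = card (S - T) + card (T - S)"
    using assms by (intro card_Un_disjoint) auto
  have S: "card S = card (S - T) + card (S \<inter> T)"
    using assms by (subst card_Un_disjoint[symmetric]) (auto intro!: arg_cong[of _ _ card])
  have T: "card T = card (T - S) + card (S \<inter> T)"
    using assms by (subst card_Un_disjoint[symmetric]) (auto intro!: arg_cong[of _ _ card])
  show "card ((S - T) \<union> (T - S)) \<noteq> 1" if "card S = card T"
    using un S T that by presburger
  have "card (S - T) = 0 \<longleftrightarrow> S \<subseteq> T"
    using assms by simp
  then show "card ((S - T) \<union> (T - S)) = 1 \<longleftrightarrow> S \<subseteq> T" if "card T = card S + 1"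
    using un S T that by linarith
qed

text \<open>The size comparisons exclude \<open>S = T\<close> and let the block of a matrix entry
  decide which inclusion applies.\<close>

lemma dominates_bits:
  fixes k defines "n \<equiv> 2 * k + 1"
  assumes S: "S \<in> layer n k \<union> layer n (k + 1)" and T: "T \<in> layer n k \<union> layer n (k + 1)"
  shows "bits n S \<rightarrow>\<^bsub>middle_cube k\<^esub> bits n T \<longleftrightarrow>
    card S < card T \<and> S \<subseteq> T \<or> card T < card S \<and> T \<subseteq> S"
proof -
  have fin: "finite S" "finite T" and sub: "S \<subseteq> {..<n}" "T \<subseteq> {..<n}"
    using S T by (auto simp: layer_def intro: finite_subset)
  have "{i. i < n \<and> bits n S ! i \<noteq> bits n T ! i} = (S - T) \<union> (T - S)"
    using sub by auto
  then have "bits n S \<rightarrow>\<^bsub>middle_cube k\<^esub> bits n T \<longleftrightarrow> card ((S - T) \<union> (T - S)) = 1"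
    using S T unfolding dominates_middle_cube_iff verts_middle_cube n_def by auto
  moreover consider "card S = card T" | "card T = card S + 1" | "card S = card T + 1"
    using S T by (auto simp: layer_def)
  then have "card ((S - T) \<union> (T - S)) = 1 \<longleftrightarrow>
    card S < card T \<and> S \<subseteq> T \<or> card T < card S \<and> T \<subseteq> S"
    using card_symmetric_difference_eq_1_iff[OF fin]
      card_symmetric_difference_eq_1_iff[OF fin(2,1)]
    by cases (auto simp: Un_commute)
  ultimately show ?thesis by simp
qed

text \<open>Listing the lower layer first puts pairs of equal size into the diagonal blocks, which
  therefore vanish.\<close>

lemma adjacency_matrix_middle_cube:
  fixes k defines "n \<equiv> 2 * k + 1"
  assumes xs: "set xs = layer n k" and ys: "set ys = layer n (k + 1)"
  shows "adjacency_matrix (middle_cube k) (map (bits n) (xs @ ys))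
       = four_block_mat (0\<^sub>m (length xs) (length xs)) (inclusion_matrix xs ys)
           (transpose_mat (inclusion_matrix xs ys)) (0\<^sub>m (length ys) (length ys))"
    (is "?L = ?R")
proof (rule eq_matI)
  fix i j assume "i < dim_row ?R" "j < dim_col ?R"
  then have ij: "i < length (xs @ ys)" "j < length (xs @ ys)"
    by auto
  have lay: "(xs @ ys) ! l \<in> (if l < length xs then layer n k else layer n (k + 1))"
    if "l < length (xs @ ys)" for l
    using that nth_mem[of l xs] nth_mem[of "l - length xs" ys] unfolding xs ys
    by (auto simp: nth_append)
  then have card: "card ((xs @ ys) ! l) = (if l < length xs then k else k + 1)"
    if "l < length (xs @ ys)" for l
    using lay[OF that] by (simp add: layer_def split: if_splits)
  have "?L $$ (i, j) = (if bits n ((xs @ ys) ! i) \<rightarrow>\<^bsub>middle_cube k\<^esub> bits n ((xs @ ys) ! j) then 1 else 0)"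
    using ij by (simp add: adjacency_matrix_def del: map_append)
  also have "\<dots> = ?R $$ (i, j)"
    unfolding n_def
    by (subst dominates_bits)
       (use lay[OF ij(1)] lay[OF ij(2)] card[OF ij(1)] card[OF ij(2)] ij in
         \<open>auto simp: n_def inclusion_matrix_def nth_append split: if_splits\<close>)
  finally show "?L $$ (i, j) = ?R $$ (i, j)" .
qed (auto simp: adjacency_matrix_def)

theorem theorem1:
  fixes k n :: nat and vs :: "bool list list"
  assumes "n = 2 * k + 1"
    and "distinct vs" and "set vs = verts (middle_cube k)"
  shows "char_poly (adjacency_matrix (middle_cube k) vs) =
    (\<Prod>i = 1..k + 1. ([:- real i, 1:] * [:real i, 1:])
      ^ (binom n (int k + 1 - int i) - binom n (int k - int i)))"
proof -
  obtain xs where xs: "distinct xs" "set xs = layer n k"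
    using finite_distinct_list[OF finite_layer, of n k] by blast
  obtain ys where ys: "distinct ys" "set ys = layer n (k + 1)"
    using finite_distinct_list[OF finite_layer, of n "k + 1"] by blast
  let ?W = "inclusion_matrix xs ys"
  \<comment> \<open>The two middle layers are equinumerous by complementation, so \<open>?W\<close>
    is square, as \<open>char_poly_bipartite\<close> requires.\<close>
  have len: "length ys = length xs"
    using length_layer_list[OF xs] length_layer_list[OF ys] binomial_symmetric[of k n] assms(1)
    by simp
  have "distinct (map (bits n) (xs @ ys))"
    unfolding distinct_map using xs ys
    by (auto simp: layer_def intro!: inj_on_subset[OF inj_on_bits])
  moreover have "set (map (bits n) (xs @ ys)) = set vs"
    using xs ys assms by (simp add: verts_middle_cube image_Un)
  ultimately have "mset vs = mset (map (bits n) (xs @ ys))"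
    using assms(2) by (metis set_eq_iff_mset_eq_distinct)
  then have "char_poly (adjacency_matrix (middle_cube k) vs)
      = char_poly (adjacency_matrix (middle_cube k) (map (bits n) (xs @ ys)))"
    unfolding adjacency_matrix_def
    by (rule char_poly_reorder[where f = "\<lambda>v w. if v \<rightarrow>\<^bsub>middle_cube k\<^esub> w then 1 else 0"])
  also have "\<dots> = char_poly (?W * transpose_mat ?W) \<circ>\<^sub>p [:0, 0, 1:]"
    unfolding assms(1) adjacency_matrix_middle_cube[OF xs(2)[unfolded assms(1)] ys(2)[unfolded assms(1)]] len
    by (rule char_poly_bipartite)
       (use inclusion_matrix_carrier[of xs ys] in \<open>simp_all only: len transpose_carrier_mat\<close>)
  also have "\<dots> = (\<Prod>i\<le>k. ([:- real (k + 1 - i), 1:] * [:real (k + 1 - i), 1:])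
      ^ (binom n (int i) - binom n (int i - 1)))"
  proof -
    \<comment> \<open>For \<open>n = 2 * k + 1\<close> both factors equal \<open>k + 1 - i\<close>;
      substituting the square of the variable thus gives a difference of two squares, which
      splits.\<close>
    have "(real k + 1 - real i) * (real n - real i - real k) = (real (k + 1 - i))\<^sup>2" if "i \<le> k" for i
      using that assms(1) by (simp add: of_nat_diff power2_eq_square algebra_simps)
    then show ?thesis
      using char_poly_up_down[OF xs ys[folded Suc_eq_plus1]] assms(1)
      by (intro poly_ext)
         (auto simp: poly_pcompose poly_prod power2_eq_square algebra_simps intro!: prod.cong)
  qed
  \<comment> \<open>The involution sending \<open>i\<close> to \<open>k + 1 - i\<close> turns the
    layer index into the positive eigenvalue.\<close>
  also have "\<dots> = (\<Prod>i = 1..k + 1. ([:- real i, 1:] * [:real i, 1:])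
      ^ (binom n (int k + 1 - int i) - binom n (int k - int i)))"
    by (rule prod.reindex_bij_witness[where i = "\<lambda>i. k + 1 - i" and j = "\<lambda>i. k + 1 - i"])
       (auto simp: of_nat_diff)
  finally show ?thesis .
qed

end
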